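(* For any CF-GKAT expression $e$, any Boolean expression $b\in\mathsf{BExp}^I$ and any indicator assignment $\pi:X\to I$, the transition set $\delta(\pi,e^{(b)})$ and the continuation set $\varepsilon(\pi,e^{(b)})$ derived from the operational rules in the context coincide with the accumulated ones: $$\delta(\pi,e^{(b)})=\mathrm{accu}_{\mathrm{res}_\delta,\mathrm{con}_\delta}(\pi)\qquad\text{and}\qquad \varepsilon(\pi,e^{(b)})=\mathrm{accu}_{\mathrm{res}_\varepsilon,\mathrm{con}_\varepsilon}(\pi).$$
   Context: Fix finite sets $T$ (primitive tests), $X$ (indicator variables), $I$ (indicator values), $L$ (labels) and a set $\Sigma$ of primitive actions. $\mathsf{BExp}$: Boolean expressions over $T$. $\mathsf{BExp}^I$: $b,c::=0\mid1\mid t\in T\mid x=i\mid b\vee c\mid b\wedge c\mid\overline b$ ($x\in X$, $i\in I$). CF-GKAT expressions: $e,f::=b\in\mathsf{BExp}^I\mid p\in\Sigma\mid x:=i\mid e\vartriangleleft f\mid e;f\mid e+_bf\mid e^{(b)}\mid\mathtt{break}\mid\mathtt{continue}\mid\mathtt{return}\mid\mathtt{goto}\,l\mid\mathtt{label}\,l$. Write $\mathtt{skip}$ for the test $1$. An indicator assignment is $\pi:X\to I$; $\pi[x\mapsto i]$ updates $x$ to $i$; $b[\pi]\in\mathsf{BExp}$ replaces each $x=i$ in $b$ by true if $\pi(x)=i$ and by false otherwise. Continuations $C$: $\mathrm{acc}\,\pi$, $\mathrm{ret}$, $\mathrm{brk}\,\pi$, $\mathrm{cont}\,\pi$, $\mathrm{jmp}(l,\pi)$.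 Boolean guards in $\mathsf{BExp}$ are taken up to Boolean-algebra equivalence. The operational rules inductively define, on states $(\pi,e)$, statements $(\pi,e)\Rightarrow^{a}c$ (meaning $(a,c)\in\varepsilon(\pi,e)\subseteq\mathsf{BExp}\times C$) and $(\pi,e)\xrightarrow{a\mid p}(\pi',e')$ (meaning $(a,(\pi',e'),p)\in\delta(\pi,e)$). Write $(\pi,e)\hookrightarrow^{a}r$ for either kind, where $r$ is a continuation or a pair (next state, action). Rules: - Primitives: for a test $b$, $(\pi,b)\Rightarrow^{b[\pi]}\mathrm{acc}\,\pi$; $(\pi,\mathtt{break})\Rightarrow^{1}\mathrm{brk}\,\pi$; $(\pi,\mathtt{continue})\Rightarrow^{1}\mathrm{cont}\,\pi$; $(\pi,\mathtt{goto}\,l)\Rightarrow^{1}\mathrm{jmp}(l,\pi)$; $(\pi,\mathtt{return})\Rightarrow^{1}\mathrm{ret}$; $(\pi,x:=i)\Rightarrow^{1}\mathrm{acc}\,\pi[x\mapsto i]$; $(\pi,\mathtt{label}\,l)\Rightarrow^1\mathrm{acc}\,\pi$; $(\pi,p)\xrightarrow{1\mid p}(\pi,\mathtt{skip})$. - Sequencing: if $(\pi,e)\Rightarrow^{b}\mathrm{acc}\,\pi'$ and $(\pi',f)\hookrightarrow^{a}r$ then $(\pi,e;f)\hookrightarrow^{b\wedge a}r$; if $(\pi,e)\xrightarrow{b\mid p}(\pi',e')$ then $(\pi,e;f)\xrightarrow{b\mid p}(\pi',e';f)$; if $(\pi,e)\Rightarrow^{b}c$ with $c$ not of the form $\mathrm{acc}\,\pi'$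 then $(\pi,e;f)\Rightarrow^{b}c$. - Unfolding: if $(\pi,e)\Rightarrow^{b}\mathrm{brk}\,\pi'$ then $(\pi,e\vartriangleleft f)\Rightarrow^{b}\mathrm{acc}\,\pi'$; if $(\pi,e)\Rightarrow^{b}c$ with $c\in\{\mathrm{cont}\,\pi',\mathrm{acc}\,\pi'\}$ and $(\pi',f)\hookrightarrow^{a}r$ then $(\pi,e\vartriangleleft f)\hookrightarrow^{b\wedge a}r$; if $(\pi,e)\Rightarrow^{b}c$ with $c\in\{\mathrm{ret},\mathrm{jmp}(l,\pi')\}$ then $(\pi,e\vartriangleleft f)\Rightarrow^{b}c$; if $(\pi,e)\xrightarrow{b\mid p}(\pi',e')$ then $(\pi,e\vartriangleleft f)\xrightarrow{b\mid p}(\pi',e'\vartriangleleft f)$. - Conditional: if $(\pi,e)\hookrightarrow^{a}r$ then $(\pi,e+_bf)\hookrightarrow^{b[\pi]\wedge a}r$; if $(\pi,f)\hookrightarrow^{a}r$ then $(\pi,e+_bf)\hookrightarrow^{\neg b[\pi]\wedge a}r$. - Loop: $(\pi,e^{(b)})\Rightarrow^{\neg b[\pi]}\mathrm{acc}\,\pi$; if $(\pi,e\vartriangleleft e^{(b)})\hookrightarrow^{a}r$ then $(\pi,e^{(b)})\hookrightarrow^{b[\pi]\wedge a}r$. Accumulation: for sets $N,R$ and functions $\mathrm{res}:N\to\mathcal P(R)$, $\mathrm{con}:N\to\mathcal P(N\times(R\to R))$, the sets $\mathrm{accu}_{\mathrm{res},\mathrm{con}}(n)\subseteq R$ are inductively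 (least) defined by: $r\in\mathrm{res}(n)$ implies $r\in\mathrm{accu}_{\mathrm{res},\mathrm{con}}(n)$; $(n',h)\in\mathrm{con}(n)$ and $r\in\mathrm{accu}_{\mathrm{res},\mathrm{con}}(n')$ imply $h(r)\in\mathrm{accu}_{\mathrm{res},\mathrm{con}}(n)$. Here $N$ is the set of indicator assignments. For $a\in\mathsf{BExp}$, $\langle a|$ is the map guarding with $a$: $\langle a|(d,s,p)=(a\wedge d,s,p)$ and $\langle a|(d,c)=(a\wedge d,c)$. For fixed $e,b$, the following functions are defined as containing exactly: - $\mathrm{res}_\delta(\pi)$: all $(b[\pi]\wedge a,(\pi',e'\vartriangleleft e^{(b)}),p)$ with $(\pi,e)\xrightarrow{a\mid p}(\pi',e')$. - $\mathrm{con}_\delta(\pi)$ and $\mathrm{con}_\varepsilon(\pi)$: all $(\pi',\langle b[\pi]\wedge a|)$ with $(\pi,e)\Rightarrow^{a}c$ and $c\in\{\mathrm{acc}\,\pi',\mathrm{cont}\,\pi'\}$. - $\mathrm{res}_\varepsilon(\pi)$: $(\neg b[\pi],\mathrm{acc}\,\pi)$; all $(b[\pi]\wedge a,\mathrm{acc}\,\pi')$ with $(\pi,e)\Rightarrow^{a}\mathrm{brk}\,\pi'$; all $(b[\pi]\wedge a,c)$ with $(\pi,e)\Rightarrow^{a}c$ and $c=\mathrm{ret}$ or $c=\mathrm{jmp}(l,\pi')$. *)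

theory Defs
  imports Main
begin

unbundle lattice_syntax

datatype 't bexp =
    BFalse
  | BTrue
  | BTest 't
  | BOr "'t bexp" "'t bexp"
  | BAnd "'t bexp" "'t bexp"
  | BNot "'t bexp"

text \<open>Boolean-algebra equivalence: the least congruence containing the axioms of Boolean algebra.\<close>

inductive ba_eq :: "'t bexp \<Rightarrow> 't bexp \<Rightarrow> bool" (infix "\<approx>\<^sub>B" 50) where
  ba_refl: "a \<approx>\<^sub>B a"
| ba_sym: "a \<approx>\<^sub>B b \<Longrightarrow> b \<approx>\<^sub>B a"
| ba_trans: "a \<approx>\<^sub>B b \<Longrightarrow> b \<approx>\<^sub>B c \<Longrightarrow> a \<approx>\<^sub>B c"
| ba_cong_or: "a \<approx>\<^sub>B a' \<Longrightarrow> b \<approx>\<^sub>B b' \<Longrightarrow> BOr a b \<approx>\<^sub>B BOr a' b'"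
| ba_cong_and: "a \<approx>\<^sub>B a' \<Longrightarrow> b \<approx>\<^sub>B b' \<Longrightarrow> BAnd a b \<approx>\<^sub>B BAnd a' b'"
| ba_cong_not: "a \<approx>\<^sub>B a' \<Longrightarrow> BNot a \<approx>\<^sub>B BNot a'"
| ba_or_assoc: "BOr (BOr a b) c \<approx>\<^sub>B BOr a (BOr b c)"
| ba_and_assoc: "BAnd (BAnd a b) c \<approx>\<^sub>B BAnd a (BAnd b c)"
| ba_or_comm: "BOr a b \<approx>\<^sub>B BOr b a"
| ba_and_comm: "BAnd a b \<approx>\<^sub>B BAnd b a"
| ba_or_absorb: "BOr a (BAnd a b) \<approx>\<^sub>B a"
| ba_and_absorb: "BAnd a (BOr a b) \<approx>\<^sub>B a"
| ba_or_distrib: "BOr a (BAnd b c) \<approx>\<^sub>B BAnd (BOr a b) (BOr a c)"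
| ba_and_distrib: "BAnd a (BOr b c) \<approx>\<^sub>B BOr (BAnd a b) (BAnd a c)"
| ba_or_unit: "BOr a BFalse \<approx>\<^sub>B a"
| ba_and_unit: "BAnd a BTrue \<approx>\<^sub>B a"
| ba_or_compl: "BOr a (BNot a) \<approx>\<^sub>B BTrue"
| ba_and_compl: "BAnd a (BNot a) \<approx>\<^sub>B BFalse"

quotient_type 't guard = "'t bexp" / ba_eq
  by (intro equivpI reflpI sympI transpI) (blast intro: ba_refl ba_sym ba_trans)+

instantiation guard :: (type) boolean_algebra
begin

lift_definition bot_guard :: "'a guard" is BFalse .
lift_definition top_guard :: "'a guard" is BTrue .
lift_definition sup_guard :: "'a guard \<Rightarrow> 'a guard \<Rightarrow> 'a guard" is BOr by (rule ba_cong_or)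
lift_definition inf_guard :: "'a guard \<Rightarrow> 'a guard \<Rightarrow> 'a guard" is BAnd by (rule ba_cong_and)
lift_definition uminus_guard :: "'a guard \<Rightarrow> 'a guard" is BNot by (rule ba_cong_not)

definition minus_guard :: "'a guard \<Rightarrow> 'a guard \<Rightarrow> 'a guard" where
  "minus_guard a b = a \<sqinter> - b"
definition less_eq_guard :: "'a guard \<Rightarrow> 'a guard \<Rightarrow> bool" where
  "less_eq_guard a b \<longleftrightarrow> a \<sqinter> b = a"
definition less_guard :: "'a guard \<Rightarrow> 'a guard \<Rightarrow> bool" where
  "less_guard a b \<longleftrightarrow> a \<le> b \<and> \<not> b \<le> a"

instance
proof
  have inf_assoc: "(a \<sqinter> b) \<sqinter> c = a \<sqinter> (b \<sqinter> c)" for a b c :: "'a guard"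
    by transfer (rule ba_and_assoc)
  have inf_comm: "a \<sqinter> b = b \<sqinter> a" for a b :: "'a guard"
    by transfer (rule ba_and_comm)
  have sup_comm: "a \<squnion> b = b \<squnion> a" for a b :: "'a guard"
    by transfer (rule ba_or_comm)
  have sup_absorb: "a \<squnion> (a \<sqinter> b) = a" for a b :: "'a guard"
    by transfer (rule ba_or_absorb)
  have inf_absorb: "a \<sqinter> (a \<squnion> b) = a" for a b :: "'a guard"
    by transfer (rule ba_and_absorb)
  have inf_distrib: "a \<sqinter> (b \<squnion> c) = (a \<sqinter> b) \<squnion> (a \<sqinter> c)" for a b c :: "'a guard"
    by transfer (rule ba_and_distrib)
  have sup_bot: "a \<squnion> \<bottom> = a" for a :: "'a guard"
    by transfer (rule ba_or_unit)
  have inf_idem: "a \<sqinter> a = a" for a :: "'a guard"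
    by (metis inf_absorb sup_absorb)
  fix x y z :: "'a guard"
  show "x < y \<longleftrightarrow> x \<le> y \<and> \<not> y \<le> x" by (simp add: less_guard_def)
  show "x \<le> x" by (simp add: less_eq_guard_def inf_idem)
  show "x \<le> y \<Longrightarrow> y \<le> z \<Longrightarrow> x \<le> z" unfolding less_eq_guard_def by (metis inf_assoc)
  show "x \<le> y \<Longrightarrow> y \<le> x \<Longrightarrow> x = y" unfolding less_eq_guard_def by (metis inf_comm)
  show "x \<sqinter> y \<le> x" unfolding less_eq_guard_def by (metis inf_assoc inf_comm inf_idem)
  show "x \<sqinter> y \<le> y" unfolding less_eq_guard_def by (metis inf_assoc inf_idem)
  show "x \<le> y \<Longrightarrow> x \<le> z \<Longrightarrow> x \<le> y \<sqinter> z" unfolding less_eq_guard_def by (metis inf_assoc)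
  show "x \<le> x \<squnion> y" unfolding less_eq_guard_def by (rule inf_absorb)
  show "y \<le> x \<squnion> y" unfolding less_eq_guard_def by (metis inf_absorb sup_comm)
  show "y \<le> x \<Longrightarrow> z \<le> x \<Longrightarrow> y \<squnion> z \<le> x"
    unfolding less_eq_guard_def by (metis inf_comm inf_distrib)
  show "\<bottom> \<le> x" unfolding less_eq_guard_def by (metis inf_absorb sup_bot sup_comm)
  show "x \<le> \<top>" unfolding less_eq_guard_def by transfer (rule ba_and_unit)
  show "x \<squnion> (y \<sqinter> z) = (x \<squnion> y) \<sqinter> (x \<squnion> z)" by transfer (rule ba_or_distrib)
  show "x \<sqinter> - x = \<bottom>" by transfer (rule ba_and_compl)
  show "x \<squnion> - x = \<top>" by transfer (rule ba_or_compl)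
  show "x - y = x \<sqinter> - y" by (rule minus_guard_def)
qed

end

datatype ('t, 'x, 'i) ibexp =
    IFalse
  | ITrue
  | ITest 't
  | IEq 'x 'i
  | IOr "('t, 'x, 'i) ibexp" "('t, 'x, 'i) ibexp"
  | IAnd "('t, 'x, 'i) ibexp" "('t, 'x, 'i) ibexp"
  | INot "('t, 'x, 'i) ibexp"

datatype ('t, 'x, 'i, 'l, 'p) expr =
    Test "('t, 'x, 'i) ibexp"
  | Act 'p
  | Assign 'x 'i
  | Unfold "('t, 'x, 'i, 'l, 'p) expr" "('t, 'x, 'i, 'l, 'p) expr" (infixr "\<lhd>" 65)
  | Seq "('t, 'x, 'i, 'l, 'p) expr" "('t, 'x, 'i, 'l, 'p) expr" (infixr ";;" 65)
  | Cond "('t, 'x, 'i) ibexp" "('t, 'x, 'i, 'l, 'p) expr" "('t, 'x, 'i, 'l, 'p) expr"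
      \<comment> \<open>\<open>Cond b e f\<close> is \<open>e +\<^sub>b f\<close>\<close>
  | Loop "('t, 'x, 'i, 'l, 'p) expr" "('t, 'x, 'i) ibexp"
      \<comment> \<open>\<open>Loop e b\<close> is the guarded loop of \<open>e\<close> under \<open>b\<close>\<close>
  | Break
  | Continue
  | Return
  | Goto 'l
  | Label 'l

abbreviation Skip :: "('t, 'x, 'i, 'l, 'p) expr" where
  "Skip \<equiv> Test ITrue"

type_synonym ('x, 'i) asgn = "'x \<Rightarrow> 'i"

primrec resolve :: "('x, 'i) asgn \<Rightarrow> ('t, 'x, 'i) ibexp \<Rightarrow> 't bexp" where
  "resolve \<pi> IFalse = BFalse"
| "resolve \<pi> ITrue = BTrue"
| "resolve \<pi> (ITest t) = BTest t"
| "resolve \<pi> (IEq x i) = (if \<pi> x = i then BTrue else BFalse)"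
| "resolve \<pi> (IOr b c) = BOr (resolve \<pi> b) (resolve \<pi> c)"
| "resolve \<pi> (IAnd b c) = BAnd (resolve \<pi> b) (resolve \<pi> c)"
| "resolve \<pi> (INot b) = BNot (resolve \<pi> b)"

text \<open>The guard \<open>b[\<pi>]\<close>, up to Boolean-algebra equivalence.\<close>

definition guard_of :: "('t, 'x, 'i) ibexp \<Rightarrow> ('x, 'i) asgn \<Rightarrow> 't guard" ("_\<lblot>_\<rblot>" [1000, 0] 1000) where
  "b\<lblot>\<pi>\<rblot> = abs_guard (resolve \<pi> b)"

datatype ('x, 'i, 'l) contn =
    Acc "('x, 'i) asgn"
  | Ret
  | Brk "('x, 'i) asgn"
  | Cont "('x, 'i) asgn"
  | Jmp 'l "('x, 'i) asgn"

type_synonym ('t, 'x, 'i, 'l, 'p) state = "('x, 'i) asgn \<times> ('t, 'x, 'i, 'l, 'p) expr"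

datatype ('t, 'x, 'i, 'l, 'p) outcome =
    Halt "('x, 'i, 'l) contn"
  | Move "('t, 'x, 'i, 'l, 'p) state" 'p

text \<open>
  \<open>hook s a r\<close> is the relation written with a hooked arrow, covering both kinds of statement; its
  two instances are \<open>s \<Rightarrow>[a] c\<close> (continuation \<open>c\<close>) and \<open>s \<midarrow>[a | p]\<rightarrow> s'\<close> (action \<open>p\<close>, next state \<open>s'\<close>).
\<close>

inductive hook :: "('t, 'x, 'i, 'l, 'p) state \<Rightarrow> 't guard \<Rightarrow> ('t, 'x, 'i, 'l, 'p) outcome \<Rightarrow> bool"
    ("_ \<hookrightarrow>[_] _" [51, 0, 51] 50)
  and halts :: "('t, 'x, 'i, 'l, 'p) state \<Rightarrow> 't guard \<Rightarrow> ('x, 'i, 'l) contn \<Rightarrow> bool"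
    ("_ \<Rightarrow>[_] _" [51, 0, 51] 50)
  and moves :: "('t, 'x, 'i, 'l, 'p) state \<Rightarrow> 't guard \<Rightarrow> 'p \<Rightarrow> ('t, 'x, 'i, 'l, 'p) state \<Rightarrow> bool"
    ("_ \<midarrow>[_ | _]\<rightarrow> _" [51, 0, 0, 51] 50)
where
  "s \<Rightarrow>[a] c \<equiv> s \<hookrightarrow>[a] Halt c"
| "s \<midarrow>[a | p]\<rightarrow> s' \<equiv> s \<hookrightarrow>[a] Move s' p"

| test: "(\<pi>, Test b) \<Rightarrow>[b\<lblot>\<pi>\<rblot>] Acc \<pi>"
| break: "(\<pi>, Break) \<Rightarrow>[\<top>] Brk \<pi>"
| continue: "(\<pi>, Continue) \<Rightarrow>[\<top>] Cont \<pi>"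
| goto: "(\<pi>, Goto l) \<Rightarrow>[\<top>] Jmp l \<pi>"
| return: "(\<pi>, Return) \<Rightarrow>[\<top>] Ret"
| assign: "(\<pi>, Assign x i) \<Rightarrow>[\<top>] Acc (\<pi>(x := i))"
| label: "(\<pi>, Label l) \<Rightarrow>[\<top>] Acc \<pi>"
| act: "(\<pi>, Act p) \<midarrow>[\<top> | p]\<rightarrow> (\<pi>, Skip)"

| seq_acc: "(\<pi>, e) \<Rightarrow>[b] Acc \<pi>' \<Longrightarrow> (\<pi>', f) \<hookrightarrow>[a] r \<Longrightarrow> (\<pi>, e ;; f) \<hookrightarrow>[b \<sqinter> a] r"
| seq_move: "(\<pi>, e) \<midarrow>[b | p]\<rightarrow> (\<pi>', e') \<Longrightarrow> (\<pi>, e ;; f) \<midarrow>[b | p]\<rightarrow> (\<pi>', e' ;; f)"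
| seq_halt: "(\<pi>, e) \<Rightarrow>[b] c \<Longrightarrow> (\<nexists>\<pi>'. c = Acc \<pi>') \<Longrightarrow> (\<pi>, e ;; f) \<Rightarrow>[b] c"

| unfold_brk: "(\<pi>, e) \<Rightarrow>[b] Brk \<pi>' \<Longrightarrow> (\<pi>, e \<lhd> f) \<Rightarrow>[b] Acc \<pi>'"
| unfold_next: "(\<pi>, e) \<Rightarrow>[b] c \<Longrightarrow> c \<in> {Cont \<pi>', Acc \<pi>'} \<Longrightarrow> (\<pi>', f) \<hookrightarrow>[a] r \<Longrightarrow>
    (\<pi>, e \<lhd> f) \<hookrightarrow>[b \<sqinter> a] r"
| unfold_exit: "(\<pi>, e) \<Rightarrow>[b] c \<Longrightarrow> c \<in> {Ret, Jmp l \<pi>'} \<Longrightarrow> (\<pi>, e \<lhd> f) \<Rightarrow>[b] c"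
| unfold_move: "(\<pi>, e) \<midarrow>[b | p]\<rightarrow> (\<pi>', e') \<Longrightarrow> (\<pi>, e \<lhd> f) \<midarrow>[b | p]\<rightarrow> (\<pi>', e' \<lhd> f)"

| cond_true: "(\<pi>, e) \<hookrightarrow>[a] r \<Longrightarrow> (\<pi>, Cond b e f) \<hookrightarrow>[b\<lblot>\<pi>\<rblot> \<sqinter> a] r"
| cond_false: "(\<pi>, f) \<hookrightarrow>[a] r \<Longrightarrow> (\<pi>, Cond b e f) \<hookrightarrow>[- b\<lblot>\<pi>\<rblot> \<sqinter> a] r"

| loop_exit: "(\<pi>, Loop e b) \<Rightarrow>[- b\<lblot>\<pi>\<rblot>] Acc \<pi>"
| loop_unfold: "(\<pi>, e \<lhd> Loop e b) \<hookrightarrow>[a] r \<Longrightarrow> (\<pi>, Loop e b) \<hookrightarrow>[b\<lblot>\<pi>\<rblot> \<sqinter> a] r"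

definition \<epsilon> :: "('t, 'x, 'i, 'l, 'p) state \<Rightarrow> ('t guard \<times> ('x, 'i, 'l) contn) set" where
  "\<epsilon> s = {(a, c). s \<Rightarrow>[a] c}"

definition \<delta> :: "('t, 'x, 'i, 'l, 'p) state \<Rightarrow> ('t guard \<times> ('t, 'x, 'i, 'l, 'p) state \<times> 'p) set" where
  "\<delta> s = {(a, s', p). s \<midarrow>[a | p]\<rightarrow> s'}"

inductive accumulates :: "('n \<Rightarrow> 'r set) \<Rightarrow> ('n \<Rightarrow> ('n \<times> ('r \<Rightarrow> 'r)) set) \<Rightarrow> 'n \<Rightarrow> 'r \<Rightarrow> bool"
  for res :: "'n \<Rightarrow> 'r set" and con :: "'n \<Rightarrow> ('n \<times> ('r \<Rightarrow> 'r)) set"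
where
  accu_res: "r \<in> res n \<Longrightarrow> accumulates res con n r"
| accu_con: "(n', h) \<in> con n \<Longrightarrow> accumulates res con n' r \<Longrightarrow> accumulates res con n (h r)"

definition accu :: "('n \<Rightarrow> 'r set) \<Rightarrow> ('n \<Rightarrow> ('n \<times> ('r \<Rightarrow> 'r)) set) \<Rightarrow> 'n \<Rightarrow> 'r set" where
  "accu res con n = {r. accumulates res con n r}"

text \<open>
  Since a triple \<open>(d, s, p)\<close> is \<open>(d, (s, p))\<close>, one polymorphic definition of \<open>\<langle>a\<bar>\<close> covers both its
  action on \<open>(d, s, p)\<close> and its action on \<open>(d, c)\<close>.
\<close>

definition guard_with :: "'t guard \<Rightarrow> 't guard \<times> 'r \<Rightarrow> 't guard \<times> 'r" ("\<langle>_\<bar>") where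
  "\<langle>a\<bar> = (\<lambda>(d, r). (a \<sqinter> d, r))"

definition res_\<delta> :: "('t, 'x, 'i, 'l, 'p) expr \<Rightarrow> ('t, 'x, 'i) ibexp \<Rightarrow> ('x, 'i) asgn \<Rightarrow>
    ('t guard \<times> ('t, 'x, 'i, 'l, 'p) state \<times> 'p) set" where
  "res_\<delta> e b \<pi> = {(b\<lblot>\<pi>\<rblot> \<sqinter> a, (\<pi>', e' \<lhd> Loop e b), p) | a p \<pi>' e'. (\<pi>, e) \<midarrow>[a | p]\<rightarrow> (\<pi>', e')}"

definition con_\<delta> :: "('t, 'x, 'i, 'l, 'p) expr \<Rightarrow> ('t, 'x, 'i) ibexp \<Rightarrow> ('x, 'i) asgn \<Rightarrow>
    (('x, 'i) asgn \<times> ('t guard \<times> ('t, 'x, 'i, 'l, 'p) state \<times> 'p \<Rightarrow>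
      't guard \<times> ('t, 'x, 'i, 'l, 'p) state \<times> 'p)) set" where
  "con_\<delta> e b \<pi> = {(\<pi>', \<langle>b\<lblot>\<pi>\<rblot> \<sqinter> a\<bar>) | a c \<pi>'. (\<pi>, e) \<Rightarrow>[a] c \<and> c \<in> {Acc \<pi>', Cont \<pi>'}}"

definition con_\<epsilon> :: "('t, 'x, 'i, 'l, 'p) expr \<Rightarrow> ('t, 'x, 'i) ibexp \<Rightarrow> ('x, 'i) asgn \<Rightarrow>
    (('x, 'i) asgn \<times> ('t guard \<times> ('x, 'i, 'l) contn \<Rightarrow> 't guard \<times> ('x, 'i, 'l) contn)) set" where
  "con_\<epsilon> e b \<pi> = {(\<pi>', \<langle>b\<lblot>\<pi>\<rblot> \<sqinter> a\<bar>) | a c \<pi>'. (\<pi>, e) \<Rightarrow>[a] c \<and> c \<in> {Acc \<pi>', Cont \<pi>'}}"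

definition res_\<epsilon> :: "('t, 'x, 'i, 'l, 'p) expr \<Rightarrow> ('t, 'x, 'i) ibexp \<Rightarrow> ('x, 'i) asgn \<Rightarrow>
    ('t guard \<times> ('x, 'i, 'l) contn) set" where
  "res_\<epsilon> e b \<pi> =
     {(- b\<lblot>\<pi>\<rblot>, Acc \<pi>)}
     \<union> {(b\<lblot>\<pi>\<rblot> \<sqinter> a, Acc \<pi>') | a \<pi>'. (\<pi>, e) \<Rightarrow>[a] Brk \<pi>'}
     \<union> {(b\<lblot>\<pi>\<rblot> \<sqinter> a, c) | a c. (\<pi>, e) \<Rightarrow>[a] c \<and> (c = Ret \<or> (\<exists>l \<pi>'. c = Jmp l \<pi>'))}"

end

theory Submission
  imports Defs
begin

text \<open>
  A derivation of \<open>(\<pi>, Loop e b) \<hookrightarrow>[a] r\<close> passes through states \<open>(\<pi>', Loop e b)\<close> and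
  \<open>(\<pi>', e \<lhd> Loop e b)\<close> only, apart from complete derivations for the body \<open>e\<close>. Each way of entering the
  body and returning to the loop is one \<open>con\<close> step, and the last pass is a \<open>res\<close> element.
\<close>

text \<open>Both accumulations are packed into one predicate on outcomes because \<open>hook\<close>
  is a single relation, so one induction serves \<open>Halt\<close> and \<open>Move\<close>
  alike.\<close>

definition accu_outcome ::
  "('t, 'x, 'i, 'l, 'p) expr \<Rightarrow> ('t, 'x, 'i) ibexp \<Rightarrow> ('x, 'i) asgn \<Rightarrow> 't guard \<Rightarrow>
    ('t, 'x, 'i, 'l, 'p) outcome \<Rightarrow> bool" where
  "accu_outcome e b \<pi> a r = (case r of
      Halt c \<Rightarrow> accumulates (res_\<epsilon> e b) (con_\<epsilon> e b) \<pi> (a, c)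
    | Move s p \<Rightarrow> accumulates (res_\<delta> e b) (con_\<delta> e b) \<pi> (a, s, p))"

lemma accu_outcome_exit: "accu_outcome e b \<pi> (- b\<lblot>\<pi>\<rblot>) (Halt (Acc \<pi>))"
  by (auto simp: accu_outcome_def res_\<epsilon>_def intro!: accu_res)

lemma accu_outcome_brk:
  "(\<pi>, e) \<Rightarrow>[a] Brk \<pi>' \<Longrightarrow> accu_outcome e b \<pi> (b\<lblot>\<pi>\<rblot> \<sqinter> a) (Halt (Acc \<pi>'))"
  by (auto simp: accu_outcome_def res_\<epsilon>_def intro!: accu_res)

lemma accu_outcome_halt:
  "(\<pi>, e) \<Rightarrow>[a] c \<Longrightarrow> c \<in> {Ret, Jmp l \<pi>'} \<Longrightarrow> accu_outcome e b \<pi> (b\<lblot>\<pi>\<rblot> \<sqinter> a) (Halt c)"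
  by (auto simp: accu_outcome_def res_\<epsilon>_def intro!: accu_res)

lemma accu_outcome_move:
  "(\<pi>, e) \<midarrow>[a | p]\<rightarrow> (\<pi>', e') \<Longrightarrow>
    accu_outcome e b \<pi> (b\<lblot>\<pi>\<rblot> \<sqinter> a) (Move (\<pi>', e' \<lhd> Loop e b) p)"
  by (auto simp: accu_outcome_def res_\<delta>_def intro!: accu_res)

text \<open>One \<open>con\<close> step, available for either kind of outcome. Associativity turns
  its guard into the one that \<open>loop_unfold\<close> after \<open>unfold_next\<close>
  yields.\<close>

lemma accu_outcome_next:
  assumes "(\<pi>, e) \<Rightarrow>[d] c" and "c \<in> {Cont \<pi>', Acc \<pi>'}" and "accu_outcome e b \<pi>' a r"
  shows "accu_outcome e b \<pi> (b\<lblot>\<pi>\<rblot> \<sqinter> (d \<sqinter> a)) r"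
proof -
  have "(\<pi>', \<langle>b\<lblot>\<pi>\<rblot> \<sqinter> d\<bar>) \<in> con_\<epsilon> e b \<pi>" "(\<pi>', \<langle>b\<lblot>\<pi>\<rblot> \<sqinter> d\<bar>) \<in> con_\<delta> e b \<pi>"
    using assms(1,2) unfolding con_\<epsilon>_def con_\<delta>_def by blast+
  note con = this
  show ?thesis
    using assms(3) accu_con[where con = "con_\<epsilon> e b", OF con(1)]
      accu_con[where con = "con_\<delta> e b", OF con(2)]
    by (fastforce simp: accu_outcome_def guard_with_def inf_assoc split: outcome.splits)
qed

text \<open>The second conjunct already carries the guard that \<open>loop_unfold\<close> would add,
  so that rule's case follows at once from its induction hypothesis.\<close>

lemma hook_imp_accu_outcome:
  assumes "s \<hookrightarrow>[a] r"
  shows "(s = (\<pi>, Loop e b) \<longrightarrow> accu_outcome e b \<pi> a r) \<and>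
         (s = (\<pi>, e \<lhd> Loop e b) \<longrightarrow> accu_outcome e b \<pi> (b\<lblot>\<pi>\<rblot> \<sqinter> a) r)"
  using assms
proof (induction arbitrary: \<pi> rule: hook.induct)
  \<comment> \<open>The continuing run starts in \<open>Loop e b\<close> at another assignment;
    generalising \<pi> makes the first conjunct available there.\<close>
  case unfold_next
  then show ?case by (blast intro: accu_outcome_next)
qed (auto intro: accu_outcome_exit accu_outcome_brk accu_outcome_halt accu_outcome_move)

text \<open>Each \<open>res\<close> element is \<open>loop_exit\<close> or one
  \<open>loop_unfold\<close> over an unfolding rule; each \<open>con\<close> step is
  \<open>loop_unfold\<close> over \<open>unfold_next\<close>.\<close>

lemma accumulates_\<epsilon>_imp_halts:
  assumes "accumulates (res_\<epsilon> e b) (con_\<epsilon> e b) \<pi> (a, c)"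
  shows "(\<pi>, Loop e b) \<Rightarrow>[a] c"
  using assms
proof (induction \<pi> "(a, c)" arbitrary: a c)
  case (accu_res \<pi>)
  then show ?case
    unfolding res_\<epsilon>_def
    by (blast intro: loop_exit loop_unfold unfold_brk unfold_exit)
next
  case (accu_con \<pi>' h \<pi> r)
  \<comment> \<open>The map \<open>h\<close> only strengthens the guard, so \<open>r\<close> has the
    same continuation \<open>c\<close>.\<close>
  obtain d where r: "r = (d, c)" and "a = fst (h (d, c))"
    using accu_con by (cases r) (auto simp: con_\<epsilon>_def guard_with_def)
  with accu_con obtain a' c' where *: "a = b\<lblot>\<pi>\<rblot> \<sqinter> (a' \<sqinter> d)"
    "(\<pi>, e) \<Rightarrow>[a'] c'" "c' \<in> {Cont \<pi>', Acc \<pi>'}"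
    by (auto simp: con_\<epsilon>_def guard_with_def inf_assoc)
  show ?case
    unfolding *(1) by (rule loop_unfold unfold_next *(2,3) accu_con(3) r)+
qed

lemma accumulates_\<delta>_imp_moves:
  assumes "accumulates (res_\<delta> e b) (con_\<delta> e b) \<pi> (a, s, p)"
  shows "(\<pi>, Loop e b) \<midarrow>[a | p]\<rightarrow> s"
  using assms
proof (induction \<pi> "(a, s, p)" arbitrary: a s p)
  case (accu_res \<pi>)
  then show ?case
    unfolding res_\<delta>_def by (blast intro: loop_unfold unfold_move)
next
  case (accu_con \<pi>' h \<pi> r)
  obtain d where r: "r = (d, s, p)" and "a = fst (h (d, s, p))"
    using accu_con by (cases r) (auto simp: con_\<delta>_def guard_with_def)
  with accu_con obtain a' c' where *: "a = b\<lblot>\<pi>\<rblot> \<sqinter> (a' \<sqinter> d)"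
    "(\<pi>, e) \<Rightarrow>[a'] c'" "c' \<in> {Cont \<pi>', Acc \<pi>'}"
    by (auto simp: con_\<delta>_def guard_with_def inf_assoc)
  show ?case
    \<comment> \<open>The body halts with guard \<open>a'\<close>, then the induction hypothesis
      gives the move of the loop with guard \<open>d\<close>.\<close>
    unfolding *(1) by (rule loop_unfold unfold_next *(2,3) accu_con(3) r)+
qed

theorem theorem4p8:
  fixes e :: "('t::finite, 'x::finite, 'i::finite, 'l::finite, 'p) expr"
    and b :: "('t, 'x, 'i) ibexp"
    and \<pi> :: "'x \<Rightarrow> 'i"
  shows "\<delta> (\<pi>, Loop e b) = accu (res_\<delta> e b) (con_\<delta> e b) \<pi> \<and>
         \<epsilon> (\<pi>, Loop e b) = accu (res_\<epsilon> e b) (con_\<epsilon> e b) \<pi>"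
proof -
  have outcome: "accu_outcome e b \<pi> a r" if "(\<pi>, Loop e b) \<hookrightarrow>[a] r" for a r
    using hook_imp_accu_outcome[OF that] by blast
  have "(\<pi>, Loop e b) \<midarrow>[a | p]\<rightarrow> s \<longleftrightarrow> accumulates (res_\<delta> e b) (con_\<delta> e b) \<pi> (a, s, p)" for a p s
    using outcome[of a "Move s p"] accumulates_\<delta>_imp_moves[of e b \<pi> a s p]
    by (auto simp: accu_outcome_def)
  moreover
  have "(\<pi>, Loop e b) \<Rightarrow>[a] c \<longleftrightarrow> accumulates (res_\<epsilon> e b) (con_\<epsilon> e b) \<pi> (a, c)" for a c
    using outcome[of a "Halt c"] accumulates_\<epsilon>_imp_halts[of e b \<pi> a c]
    by (auto simp: accu_outcome_def)
  ultimately show ?thesis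
    by (auto simp: \<delta>_def \<epsilon>_def accu_def)
qed

end
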